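(* Let a sequence of sparse vectors $\{\mathbf{x}^{(M)}\in\mathbb{C}^M\}_M$ with $\|\mathbf{x}^{(M)}\|_0=L=\lfloor\frac1\beta M\rfloor$, where $\beta>2$, be given such that $P$ is constant. Then asymptotic reliable recovery is not possible for $\{\mathbf{x}^{(M)}\}$ with respect to Error Metric 2 if $N\prec C_4 L$, for some constant $C_4\ge0$ that depends only on $\alpha$, $\beta$, $P$ and $\nu$.
   Context: Model: $\mathbf{x}=\mathbf{x}^{(M)}\in\mathbb{C}^M$ is an unknown vector with support $\mathcal{I}=\{i: x_i\ne0\}$, $\|\mathbf{x}\|_0=|\mathcal{I}|=L$, and total power $P=\|\mathbf{x}\|_2^2$. One observes $\mathbf{y}=\mathbf{A}\mathbf{x}+\mathbf{n}\in\mathbb{C}^N$, where $N$ is a function of $M$, $\mathbf{A}$ is an $N\times M$ Gaussian measurement matrix (i.i.d. circularly symmetric complex Gaussian entries $a_{i,j}\sim\mathcal{N}_C(0,1)$), and $\mathbf{n}\sim\mathcal{N}_C(0,\nu^2I_N)$ is circularly symmetric complex Gaussian noise independent of $\mathbf{A}$. Decoder: a sparse recovery algorithm, knowing $\mathbf{A}$ and observing $\mathbf{y}$, outputs an estimate $\hat{\mathbf{x}}$ with $\|\hat{\mathbf{x}}\|_0=L$; a decoder $\mathcal{D}$ outputs the corresponding set of indices $\mathcal{D}(\mathbf{y})=\{i:\hat x_i\ne0\}$. Error Metric 2 (with parameter $\alpha\in(0,1)$): recovery is successful iff $\frac{|\{i:\hat x_i\ne0\}\cap\mathcal{I}|}{|\mathcal{I}|}>1-\alpha$;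 otherwise an error occurs. For fixed $\mathbf{A}$, $p_{\rm err}(\mathbf{A}|\mathbf{x}^{(M)})$ is the probability of error, and $p_{\rm err}(\mathcal{D}|\mathbf{x}^{(M)})=\mathbb{E}_{\mathbf{A}}\big(p_{\rm err}(\mathbf{A}|\mathbf{x}^{(M)})\big)$. Asymptotic reliable recovery is not possible if, for any decoder, $p_{\rm err}(\mathcal{D}|\mathbf{x}^{(M)})$ stays bounded away from $0$ as $M\to\infty$. Notation: $f\succ g$ means that either $f=g=0$, or $f,g$ are non-decreasing non-negative functions and there is $x_0$ such that $f(x)/g(x)>1$ for all $x>x_0$ (here as functions of $M$); $f\prec g$ means $g\succ f$.
   Formalization: The error probability is averaged over all permutations of the coordinates of x^(M), since for a fixed known x^(M) the decoder that always outputs its support never errs; also N≥1 and ν>0 are assumed, and C_4>0 is shown when α<1-1/β. *)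

theory Defs
  imports "HOL-Probability.Probability" "HOL-Combinatorics.Permutations"
begin

text \<open>
  Vectors in \<open>\<complex>\<^sup>M\<close> are functions \<^typ>\<open>nat \<Rightarrow> complex\<close> of which only the coordinates \<open>i < M\<close> matter;
  an \<open>N \<times> M\<close> matrix is a function of index pairs \<open>(i, j)\<close> with \<open>i < N\<close> and \<open>j < M\<close>.
\<close>

definition supp :: "nat \<Rightarrow> (nat \<Rightarrow> complex) \<Rightarrow> nat set" where
  "supp M x = {i. i < M \<and> x i \<noteq> 0}"

text \<open>
  The circularly symmetric complex Gaussian of mean 0 and total variance \<open>v > 0\<close>: independent
  real and imaginary parts, each of variance \<open>v / 2\<close> (\<^const>\<open>normal_density\<close> takes the standard deviation).
\<close>

definition cgauss :: "real \<Rightarrow> complex measure" where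
  "cgauss v = distr
     (density lborel (normal_density 0 (sqrt (v / 2))) \<Otimes>\<^sub>M density lborel (normal_density 0 (sqrt (v / 2))))
     borel (\<lambda>(a, b). Complex a b)"

definition gauss_matrix :: "nat \<Rightarrow> nat \<Rightarrow> (nat \<times> nat \<Rightarrow> complex) measure" where
  "gauss_matrix N M = (\<Pi>\<^sub>M ij \<in> {..<N} \<times> {..<M}. cgauss 1)"

definition gauss_noise :: "real \<Rightarrow> nat \<Rightarrow> (nat \<Rightarrow> complex) measure" where
  "gauss_noise \<nu> N = (\<Pi>\<^sub>M i \<in> {..<N}. cgauss (\<nu>\<^sup>2))"

definition observe ::
    "nat \<Rightarrow> nat \<Rightarrow> (nat \<times> nat \<Rightarrow> complex) \<Rightarrow> (nat \<Rightarrow> complex) \<Rightarrow> (nat \<Rightarrow> complex) \<Rightarrow> nat \<Rightarrow> complex" where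
  "observe N M A x n = (\<lambda>i\<in>{..<N}. (\<Sum>j<M. A (i, j) * x j) + n i)"

text \<open>
  A decoder sees \<open>A\<close> and \<open>y\<close> and returns the support of an estimate with exactly \<open>L\<close> nonzero entries,
  i.e. an \<open>L\<close>-element set of indices. Measurability is needed for its error probability to make sense.
\<close>

definition decoder ::
    "nat \<Rightarrow> nat \<Rightarrow> nat \<Rightarrow> ((nat \<times> nat \<Rightarrow> complex) \<Rightarrow> (nat \<Rightarrow> complex) \<Rightarrow> nat set) \<Rightarrow> bool" where
  "decoder N M L D \<longleftrightarrow>
     case_prod D \<in> measurable
       ((\<Pi>\<^sub>M ij \<in> {..<N} \<times> {..<M}. borel) \<Otimes>\<^sub>M (\<Pi>\<^sub>M i \<in> {..<N}. borel))
       (count_space {J. J \<subseteq> {..<M} \<and> card J = L})"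

definition success2 :: "real \<Rightarrow> nat set \<Rightarrow> nat set \<Rightarrow> bool" where
  "success2 \<alpha> I J \<longleftrightarrow> real (card (J \<inter> I)) / real (card I) > 1 - \<alpha>"

definition p_err_given ::
    "real \<Rightarrow> real \<Rightarrow> nat \<Rightarrow> nat \<Rightarrow> ((nat \<times> nat \<Rightarrow> complex) \<Rightarrow> (nat \<Rightarrow> complex) \<Rightarrow> nat set) \<Rightarrow>
     (nat \<times> nat \<Rightarrow> complex) \<Rightarrow> (nat \<Rightarrow> complex) \<Rightarrow> real" where
  "p_err_given \<alpha> \<nu> N M D A x =
     measure (gauss_noise \<nu> N)
       {n \<in> space (gauss_noise \<nu> N). \<not> success2 \<alpha> (supp M x) (D A (observe N M A x n))}"

definition p_err ::
    "real \<Rightarrow> real \<Rightarrow> nat \<Rightarrow> nat \<Rightarrow> ((nat \<times> nat \<Rightarrow> complex) \<Rightarrow> (nat \<Rightarrow> complex) \<Rightarrow> nat set) \<Rightarrow>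
     (nat \<Rightarrow> complex) \<Rightarrow> real" where
  "p_err \<alpha> \<nu> N M D x = (\<integral>A. p_err_given \<alpha> \<nu> N M D A x \<partial>gauss_matrix N M)"

text \<open>
  The vector is unknown to the decoder. A decoder that always returns the support of the given \<open>x M\<close>
  makes no error at \<open>x M\<close>, so this has to be encoded: the decoder may depend on everything
  (even on the nonzero values of \<open>x M\<close>) except on which coordinates carry them, and its error
  probability is averaged over all relabellings \<open>x M \<circ> \<pi>\<close> of the coordinates. This is the error
  probability at \<open>x M\<close> itself of the decoder that first relabels the coordinates uniformly at random;
  since the columns of \<open>A\<close> are exchangeable, for a decoder that is equivariant under relabelling
  (up to null sets) the average is just \<open>p_err\<close> at \<open>x M\<close>. The average is a lower bound for the
  worst-case error probability over relabellings.
\<close>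

definition p_err_unknown ::
    "real \<Rightarrow> real \<Rightarrow> nat \<Rightarrow> nat \<Rightarrow> ((nat \<times> nat \<Rightarrow> complex) \<Rightarrow> (nat \<Rightarrow> complex) \<Rightarrow> nat set) \<Rightarrow>
     (nat \<Rightarrow> complex) \<Rightarrow> real" where
  "p_err_unknown \<alpha> \<nu> N M D x =
     (\<Sum>\<pi> | \<pi> permutes {..<M}. p_err \<alpha> \<nu> N M D (x \<circ> \<pi>)) / fact M"

definition reliable_recovery_impossible ::
    "real \<Rightarrow> real \<Rightarrow> (nat \<Rightarrow> nat) \<Rightarrow> (nat \<Rightarrow> nat) \<Rightarrow> (nat \<Rightarrow> nat \<Rightarrow> complex) \<Rightarrow> bool" where
  "reliable_recovery_impossible \<alpha> \<nu> N L x \<longleftrightarrow>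
     (\<forall>D. (\<forall>M. decoder (N M) M (L M) (D M)) \<longrightarrow>
        (\<exists>\<epsilon>>0. \<forall>\<^sub>F M in sequentially. p_err_unknown \<alpha> \<nu> (N M) M (D M) (x M) \<ge> \<epsilon>))"

definition asymp_succ :: "(nat \<Rightarrow> real) \<Rightarrow> (nat \<Rightarrow> real) \<Rightarrow> bool" where
  "asymp_succ f g \<longleftrightarrow>
     (\<forall>M. f M = 0 \<and> g M = 0) \<or>
     (mono f \<and> mono g \<and> (\<forall>M. f M \<ge> 0 \<and> g M \<ge> 0) \<and> (\<exists>M0. \<forall>M>M0. f M / g M > 1))"

abbreviation asymp_prec :: "(nat \<Rightarrow> real) \<Rightarrow> (nat \<Rightarrow> real) \<Rightarrow> bool" where
  "asymp_prec f g \<equiv> asymp_succ g f"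

end

theory Submission
  imports Defs
begin

text \<open>
  Change of measure instead of Fano's inequality. Put \<open>w = P + \<nu>\<^sup>2\<close>, the variance of each
  coordinate of \<open>y\<close>. Given \<open>A\<close>, the density of \<open>y\<close> with respect to i.i.d. \<open>cgauss w\<close> coordinates is at
  most \<open>(w / \<nu>\<^sup>2)^N * exp (norm(y)\<^sup>2 / w)\<close>, whatever \<open>x\<close> is; by Markov's inequality
  \<open>norm(y)\<^sup>2 \<le> 2 * N * w\<close> with probability at least 1/2, and there the density is at most \<open>K^N\<close> with
  \<open>K = w / \<nu>\<^sup>2 * exp 2\<close>. Under the reference measure \<open>y\<close> carries no information on the random relabelling,
  so the decoder outputs a set that is independent of the uniformly random support, and a
  hypergeometric Chernoff bound makes the average success probability at most \<open>\<rho>^L\<close>, where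
  \<open>\<rho> < 1\<close> can be achieved because the expected overlap fraction \<open>1 / \<beta>\<close> is below \<open>1 - \<alpha>\<close>. Hence the
  success probability is at most \<open>1/2 + K^N * \<rho>^L\<close>, and the last term vanishes if \<open>N \<le> C * L\<close> with
  \<open>C = - ln \<rho> / (2 * ln K)\<close>. For \<open>\<alpha> \<ge> 1 - 1 / \<beta>\<close> the choice \<open>C4 = 0\<close> contradicts \<open>N \<ge> 1\<close>.
\<close>

section \<open>Overlap with a uniformly random support\<close>

text \<open>Choosing the images of \<open>T\<close> one after another gives the exact proportion, a
  product of ratios \<open>(card I - j) / (card S - j)\<close>. Each ratio is at most
  \<open>card I / card S\<close> because \<open>card I \<le> card S\<close>.\<close>

lemma card_permutes_image_subset_le:
  assumes "finite T" "finite S" "T \<subseteq> S" "I \<subseteq> S"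
  shows "real (card {\<pi>. \<pi> permutes S \<and> \<pi> ` T \<subseteq> I})
    \<le> fact (card S) * (real (card I) / real (card S)) ^ card T"
  using assms
proof (induction T arbitrary: S I rule: finite_induct)
  case empty
  then show ?case
    by (simp add: card_permutations)
next
  case (insert t T)
  define S' where "S' = S - {t}"
  have S: "S = insert t S'" "t \<notin> S'" "finite S'"
    using insert.prems by (auto simp: S'_def)
  have fin [simp]: "finite {\<pi>. \<pi> permutes S}" "finite {\<pi>. \<pi> permutes S'}"
    using insert.prems S by (auto intro: finite_permutations)
  have cS: "card S = Suc (card S')" using S by simp
  have TS: "T \<subseteq> S'" using insert by (auto simp: S'_def)
  have finI: "finite I" using insert.prems finite_subset by blast
  have cI: "card I \<le> card S" using insert.prems card_mono by blast
  \<comment> \<open>The bound from the induction hypothesis for \<open>S'\<close> and a target set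
    with one element fewer. The subtraction is in the reals, so \<open>card I = 0\<close> is treated
    separately at the end.\<close>
  define c where "c = fact (card S') * ((real (card I) - 1) / real (card S')) ^ card T"
  have "real (card {\<pi>. \<pi> permutes S \<and> \<pi> ` insert t T \<subseteq> I})
      = (\<Sum>\<pi> | \<pi> permutes S. of_bool (\<pi> ` insert t T \<subseteq> I))"
    using fin by (simp add: sum_of_bool_eq Int_def conj_commute)
  \<comment> \<open>Here \<open>b\<close> is the image of \<open>t\<close>: the permutation
    \<open>q\<close> fixes \<open>t\<close>, and the transposition then carries \<open>t\<close> to
    \<open>b\<close>.\<close>
  also have "\<dots> = (\<Sum>b\<in>S. \<Sum>q | q permutes S'. of_bool ((Transposition.transpose t b \<circ> q) ` insert t T \<subseteq> I))"
    unfolding S(1) by (rule sum_over_permutations_insert[OF S(3,2)])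
  also have "\<dots> \<le> (\<Sum>b\<in>S. if b \<in> I then c else 0)"
  proof (rule sum_mono)
    fix b assume "b \<in> S"
    have q_t: "q t = t" if "q permutes S'" for q
      using that S(2) permutes_not_in by metis
    show "(\<Sum>q | q permutes S'. of_bool ((Transposition.transpose t b \<circ> q) ` insert t T \<subseteq> I))
        \<le> (if b \<in> I then c else 0)"
    proof (cases "b \<in> I")
      case False
      then show ?thesis by (auto simp: q_t intro!: sum_nonpos)
    next
      case True
      \<comment> \<open>Pulling \<open>I\<close> back through the transposition, which is its own
        inverse, turns the condition on \<open>T\<close> into one on \<open>q\<close> alone. The
        point \<open>t\<close> is dropped because it corresponds to the value \<open>b\<close>,
        already taken.\<close>
      define I' where "I' = Transposition.transpose t b ` I - {t}"
      have "t \<in> Transposition.transpose t b ` I" using True by (metis image_eqI transpose_apply_second)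
      moreover have "card (Transposition.transpose t b ` I) = card I"
        by (rule card_image) (metis inj_onI transpose_involutory)
      ultimately have "card I' = card I - 1"
        unfolding I'_def using finI by simp
      moreover have "card I > 0"
        using True finI card_gt_0_iff by blast
      ultimately have cI': "real (card I') = real (card I) - 1"
        by (simp add: of_nat_diff)
      have I'S: "I' \<subseteq> S'"
        unfolding I'_def S'_def using insert.prems \<open>b \<in> S\<close> S(1) by (auto simp: Transposition.transpose_def)
      have "(\<Sum>q | q permutes S'. of_bool ((Transposition.transpose t b \<circ> q) ` insert t T \<subseteq> I))
          \<le> (\<Sum>q | q permutes S'. of_bool (q ` T \<subseteq> I') :: real)"
      proof (rule sum_mono)
        fix q assume "q \<in> {q. q permutes S'}"
        then have q: "q permutes S'" by simp
        have "q ` T \<subseteq> I'" if *: "(Transposition.transpose t b \<circ> q) ` insert t T \<subseteq> I"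
        proof
          fix y assume "y \<in> q ` T"
          then obtain i where i: "i \<in> T" "y = q i" by auto
          have "y \<in> S'" using i TS q permutes_in_image by fastforce
          moreover have "Transposition.transpose t b y \<in> I" using * i by auto
          then have "y \<in> Transposition.transpose t b ` I" by (metis image_eqI transpose_involutory)
          ultimately show "y \<in> I'" by (auto simp: I'_def S'_def)
        qed
        then show "of_bool ((Transposition.transpose t b \<circ> q) ` insert t T \<subseteq> I) \<le> (of_bool (q ` T \<subseteq> I') :: real)"
          by auto
      qed
      also have "\<dots> = real (card {q. q permutes S' \<and> q ` T \<subseteq> I'})"
        using fin by (simp add: sum_of_bool_eq Int_def conj_commute)
      also have "\<dots> \<le> c"
        unfolding c_def cI'[symmetric] by (rule insert.IH[OF S(3) TS I'S])
      finally show ?thesis using True by simp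
    qed
  qed
  also have "\<dots> = real (card I) * c"
    using insert.prems by (simp add: sum.If_cases Int_absorb1)
  also have "\<dots> \<le> fact (card S) * (real (card I) / real (card S)) ^ card (insert t T)"
  proof (cases "card I = 0")
    case False
    \<comment> \<open>For \<open>card S' = 0\<close> the left side is 0 by the convention on
      division; otherwise cross-multiplication leaves \<open>card I \<le> card S\<close>.\<close>
    have "(real (card I) - 1) / real (card S') \<le> real (card I) / real (card S)"
      using cI cS by (cases "card S' = 0") (auto simp: field_simps)
    then have "c \<le> fact (card S') * (real (card I) / real (card S)) ^ card T"
      unfolding c_def using False by (intro mult_left_mono power_mono) auto
    then have "real (card I) * c
        \<le> real (card I) * (fact (card S') * (real (card I) / real (card S)) ^ card T)"
      by (rule mult_left_mono) auto
    also have "\<dots> = fact (card S) * (real (card I) / real (card S)) ^ card (insert t T)"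
    proof -
      have "real (card I) * fact (card S') = fact (card S) * (real (card I) / real (card S))"
        using cS by simp
      then show ?thesis using insert.hyps by (simp add: mult.assoc[symmetric])
    qed
    finally show ?thesis .
  qed auto
  finally show ?case .
qed

text \<open>Chernoff's method: Markov's inequality for \<open>(1 + s) ^ X\<close> with
  \<open>X\<close> the overlap. Expanding over subsets of \<open>J\<close> reduces this moment to
  the preceding count, so it is dominated by that of a binomial variable with success probability
  \<open>card I / card S\<close>.\<close>

lemma card_permutes_large_overlap_le:
  fixes s k :: real
  assumes "finite S" "J \<subseteq> S" "I \<subseteq> S" "s > 0"
  shows "real (card {\<pi>. \<pi> permutes S \<and> real (card {i\<in>J. \<pi> i \<in> I}) > k})
    \<le> fact (card S) * ((1 + s * (card I / card S)) ^ card J / (1 + s) powr k)"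
proof -
  define q where "q = real (card I) / real (card S)"
  have finJ: "finite J" using assms finite_subset by blast
  have finp [simp]: "finite {\<pi>. \<pi> permutes S}" using assms finite_permutations by blast
  \<comment> \<open>Each index contributes the factor
    \<open>1 + s * of_bool (\<pi> i \<in> I)\<close>, and the product of these is expanded over
    subsets.\<close>
  have pow: "(1 + s) ^ card {i\<in>J. \<pi> i \<in> I} = (\<Sum>T\<in>Pow J. s ^ card T * of_bool (\<pi> ` T \<subseteq> I))" for \<pi>
  proof -
    have "(\<Sum>T\<in>Pow J. s ^ card T * of_bool (\<pi> ` T \<subseteq> I)) = (\<Sum>T\<in>Pow J. \<Prod>i\<in>T. s * of_bool (\<pi> i \<in> I))"
    proof (rule sum.cong)
      fix T assume "T \<in> Pow J"
      then have "finite T" using finJ finite_subset by auto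
      then show "s ^ card T * of_bool (\<pi> ` T \<subseteq> I) = (\<Prod>i\<in>T. s * of_bool (\<pi> i \<in> I))"
        by (cases "\<pi> ` T \<subseteq> I") (auto simp: prod.distrib image_subset_iff intro!: prod.neutral)
    qed simp
    also have "\<dots> = (\<Prod>i\<in>J. s * of_bool (\<pi> i \<in> I) + 1)"
      using prod_add[OF finJ, of "\<lambda>i. s * of_bool (\<pi> i \<in> I)" "\<lambda>_. 1"] by simp
    also have "\<dots> = (\<Prod>i\<in>J. if \<pi> i \<in> I then 1 + s else 1)"
      by (rule prod.cong) auto
    also have "\<dots> = (1 + s) ^ card {i\<in>J. \<pi> i \<in> I}"
      using finJ by (simp add: prod.If_cases Int_def)
    finally show ?thesis by simp
  qed
  have "real (card {\<pi>. \<pi> permutes S \<and> real (card {i\<in>J. \<pi> i \<in> I}) > k}) * (1 + s) powr k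
      = (\<Sum>\<pi> | \<pi> permutes S \<and> real (card {i\<in>J. \<pi> i \<in> I}) > k. (1 + s) powr k)"
    by simp
  also have "\<dots> \<le> (\<Sum>\<pi> | \<pi> permutes S \<and> real (card {i\<in>J. \<pi> i \<in> I}) > k. (1 + s) ^ card {i\<in>J. \<pi> i \<in> I})"
  proof (rule sum_mono)
    fix \<pi> assume "\<pi> \<in> {\<pi>. \<pi> permutes S \<and> real (card {i\<in>J. \<pi> i \<in> I}) > k}"
    then have "(1 + s) powr k \<le> (1 + s) powr real (card {i\<in>J. \<pi> i \<in> I})"
      using assms by (intro powr_mono) auto
    then show "(1 + s) powr k \<le> (1 + s) ^ card {i\<in>J. \<pi> i \<in> I}"
      using assms by (simp add: powr_realpow)
  qed
  also have "\<dots> \<le> (\<Sum>\<pi> | \<pi> permutes S. (1 + s) ^ card {i\<in>J. \<pi> i \<in> I})"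
    using assms by (intro sum_mono2) auto
  also have "\<dots> = (\<Sum>T\<in>Pow J. s ^ card T * (\<Sum>\<pi> | \<pi> permutes S. of_bool (\<pi> ` T \<subseteq> I)))"
    unfolding pow sum_distrib_left by (rule sum.swap)
  also have "\<dots> \<le> (\<Sum>T\<in>Pow J. s ^ card T * (fact (card S) * q ^ card T))"
  proof (intro sum_mono mult_left_mono)
    fix T assume "T \<in> Pow J"
    then have "finite T" "T \<subseteq> S" using finJ finite_subset assms by auto
    then have "real (card {\<pi>. \<pi> permutes S \<and> \<pi> ` T \<subseteq> I}) \<le> fact (card S) * q ^ card T"
      unfolding q_def using assms by (intro card_permutes_image_subset_le) auto
    then show "(\<Sum>\<pi> | \<pi> permutes S. of_bool (\<pi> ` T \<subseteq> I)) \<le> fact (card S) * q ^ card T"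
      by (simp add: sum_of_bool_eq Int_def conj_commute)
  qed (use assms in auto)
  also have "\<dots> = fact (card S) * (\<Sum>T\<in>Pow J. \<Prod>i\<in>T. s * q)"
    by (simp add: sum_distrib_left power_mult_distrib mult_ac)
  \<comment> \<open>The same subset expansion read backwards, now with a constant factor.\<close>
  also have "\<dots> = fact (card S) * (\<Prod>i\<in>J. s * q + 1)"
    using prod_add[OF finJ, of "\<lambda>i. s * q" "\<lambda>_. 1"] by simp
  finally show ?thesis
    using assms by (simp add: q_def field_simps add.commute)
qed

text \<open>The logarithms of the two sides agree at \<open>s = 0\<close> and have derivatives
  \<open>p\<close> and \<open>a\<close> there, so the strict gap persists for small positive
  \<open>s\<close>. This makes the base of the Chernoff bound smaller than 1.\<close>

lemma exists_chernoff_parameter: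
  fixes p a :: real
  assumes "0 \<le> p" "p < a"
  shows "\<exists>s>0. 1 + s * p < (1 + s) powr a"
proof -
  define f where "f = (\<lambda>s. a * ln (1 + s) - ln (1 + s * p))"
  have "(f has_real_derivative a - p) (at 0)"
    unfolding f_def by (auto intro!: derivative_eq_intros)
  from DERIV_pos_inc_right[OF this] assms obtain d where d: "d > 0" "\<And>h. h > 0 \<Longrightarrow> h < d \<Longrightarrow> f 0 < f (0 + h)"
    by auto
  define s where "s = d / 2"
  have "s > 0" "0 < f s" using d(1) d(2)[of s] by (auto simp: s_def f_def)
  then have "ln (1 + s * p) < ln ((1 + s) powr a)"
    by (simp add: f_def ln_powr)
  moreover have "1 + s * p > 0"
    using \<open>s > 0\<close> assms by (simp add: add_pos_nonneg)
  ultimately have "1 + s * p < (1 + s) powr a"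
    using \<open>s > 0\<close> by (subst (asm) ln_less_cancel_iff) auto
  then show ?thesis using \<open>s > 0\<close> by blast
qed

section \<open>The complex Gaussian\<close>

lemma borel_measurable_Complex [measurable]:
  "(\<lambda>(a, b). Complex a b) \<in> borel_measurable (borel \<Otimes>\<^sub>M borel)"
proof -
  have "(\<lambda>p. complex_of_real (fst p) + \<i> * complex_of_real (snd p)) \<in> borel_measurable (borel \<Otimes>\<^sub>M borel)"
    by measurable
  then show ?thesis by (simp add: Complex_eq split_beta)
qed

lemma sets_cgauss [simp, measurable_cong]: "sets (cgauss v) = sets borel"
  by (simp add: cgauss_def)

lemma space_cgauss [simp]: "space (cgauss v) = UNIV"
  by (simp add: cgauss_def)

lemma prob_space_cgauss:
  assumes "v > 0"
  shows "prob_space (cgauss v)"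
proof -
  interpret prob_space "density lborel (normal_density 0 (sqrt (v / 2)))"
    using assms by (intro prob_space_normal_density) auto
  interpret pair_prob_space "density lborel (normal_density 0 (sqrt (v / 2)))"
    "density lborel (normal_density 0 (sqrt (v / 2)))" ..
  show ?thesis
    unfolding cgauss_def by (rule prob_space_distr) measurable
qed

text \<open>Makes affine substitutions in the real and imaginary parts available.\<close>

lemma nn_integral_cgauss:
  assumes [measurable]: "f \<in> borel_measurable borel" and "v > 0"
  shows "(\<integral>\<^sup>+z. f z \<partial>cgauss v) = (\<integral>\<^sup>+a. \<integral>\<^sup>+b.
    ennreal (normal_density 0 (sqrt (v / 2)) a * normal_density 0 (sqrt (v / 2)) b) * f (Complex a b) \<partial>lborel \<partial>lborel)"
proof -
  let ?\<phi> = "normal_density 0 (sqrt (v / 2))"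
  interpret p: prob_space "density lborel ?\<phi>"
    using assms by (intro prob_space_normal_density) auto
  have "(\<integral>\<^sup>+z. f z \<partial>cgauss v)
      = (\<integral>\<^sup>+p. f (case p of (a, b) \<Rightarrow> Complex a b) \<partial>(density lborel ?\<phi> \<Otimes>\<^sub>M density lborel ?\<phi>))"
    unfolding cgauss_def by (rule nn_integral_distr) measurable
  also have "\<dots> = (\<integral>\<^sup>+a. \<integral>\<^sup>+b. f (Complex a b) \<partial>density lborel ?\<phi> \<partial>density lborel ?\<phi>)"
    by (subst p.nn_integral_fst[symmetric]) simp_all
  also have "\<dots> = (\<integral>\<^sup>+a. \<integral>\<^sup>+b. ennreal (?\<phi> a * ?\<phi> b) * f (Complex a b) \<partial>lborel \<partial>lborel)"
    by (simp add: nn_integral_density nn_integral_cmult[symmetric] ennreal_mult' mult.assoc)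
  finally show ?thesis .
qed

text \<open>The real normal density is even, so the two coordinates can be reflected in
  turn.\<close>

lemma nn_integral_cgauss_uminus:
  assumes [measurable]: "f \<in> borel_measurable borel" and "v > 0"
  shows "(\<integral>\<^sup>+z. f (- z) \<partial>cgauss v) = (\<integral>\<^sup>+z. f z \<partial>cgauss v)"
proof -
  let ?\<phi> = "normal_density 0 (sqrt (v / 2))"
  have even: "?\<phi> (- x) = ?\<phi> x" for x by (simp add: normal_density_def)
  have "(\<integral>\<^sup>+z. f z \<partial>cgauss v)
      = (\<integral>\<^sup>+a. \<integral>\<^sup>+b. ennreal (?\<phi> a * ?\<phi> b) * f (Complex a b) \<partial>lborel \<partial>lborel)"
    using assms by (rule nn_integral_cgauss)
  also have "\<dots> = (\<integral>\<^sup>+a. \<integral>\<^sup>+b. ennreal (?\<phi> a * ?\<phi> b) * f (Complex (-a) b) \<partial>lborel \<partial>lborel)"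
    by (subst nn_integral_real_affine[where c="-1" and t=0]) (simp_all add: even)
  also have "\<dots> = (\<integral>\<^sup>+a. \<integral>\<^sup>+b. ennreal (?\<phi> a * ?\<phi> b) * f (Complex (-a) (-b)) \<partial>lborel \<partial>lborel)"
    by (rule nn_integral_cong, subst nn_integral_real_affine[where c="-1" and t=0]) (simp_all add: even)
  also have "\<dots> = (\<integral>\<^sup>+z. f (- z) \<partial>cgauss v)"
    using assms by (simp add: nn_integral_cgauss uminus_complex.code)
  finally show ?thesis ..
qed

lemma nn_integral_cgauss_norm_sq:
  assumes "v > 0"
  shows "(\<integral>\<^sup>+z. ennreal ((cmod z)\<^sup>2) \<partial>cgauss v) = ennreal v"
proof -
  let ?\<phi> = "normal_density 0 (sqrt (v / 2))"
  have one: "(\<integral>\<^sup>+x. ennreal (?\<phi> x) \<partial>lborel) = 1"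
    using assms by (subst nn_integral_eq_integral) auto
  have int: "(LBINT x. ?\<phi> x * x\<^sup>2) = v / 2"
    using integral_normal_moment_even[of "sqrt (v / 2)" 0 1] assms by (simp add: fact_numeral)
  have "integrable lborel (\<lambda>x. ?\<phi> x * x\<^sup>2)"
    using integrable_normal_moment[of "sqrt (v / 2)" 0 2] assms by simp
  then have "(\<integral>\<^sup>+x. ennreal (?\<phi> x * x\<^sup>2) \<partial>lborel) = ennreal (LBINT x. ?\<phi> x * x\<^sup>2)"
    by (rule nn_integral_eq_integral) auto
  then have two: "(\<integral>\<^sup>+x. ennreal (?\<phi> x * x\<^sup>2) \<partial>lborel) = ennreal (v / 2)"
    by (simp only: int)
  have "(\<integral>\<^sup>+z. ennreal ((cmod z)\<^sup>2) \<partial>cgauss v)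
      = (\<integral>\<^sup>+a. \<integral>\<^sup>+b. ennreal (?\<phi> a * ?\<phi> b) * ennreal (a\<^sup>2 + b\<^sup>2) \<partial>lborel \<partial>lborel)"
    using assms by (simp add: nn_integral_cgauss cmod_power2)
  also have "\<dots> = (\<integral>\<^sup>+a. \<integral>\<^sup>+b. ennreal (?\<phi> a * a\<^sup>2) * ennreal (?\<phi> b) + ennreal (?\<phi> a) * ennreal (?\<phi> b * b\<^sup>2) \<partial>lborel \<partial>lborel)"
    by (simp add: ennreal_mult'[symmetric] ennreal_plus[symmetric] algebra_simps del: ennreal_plus)
  also have "\<dots> = (\<integral>\<^sup>+a. ennreal (?\<phi> a * a\<^sup>2) + ennreal (?\<phi> a) * ennreal (v / 2) \<partial>lborel)"
    by (simp add: nn_integral_add nn_integral_cmult one two)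
  also have "\<dots> = ennreal (v / 2) + ennreal (v / 2)"
    by (simp add: nn_integral_add nn_integral_multc one two)
  finally show ?thesis using assms by (simp flip: ennreal_plus)
qed

lemma nn_integral_cgauss_affine_norm_sq:
  assumes "v > 0"
  shows "(\<integral>\<^sup>+z. ennreal ((cmod (u + c * z))\<^sup>2) \<partial>cgauss v) = ennreal ((cmod u)\<^sup>2 + (cmod c)\<^sup>2 * v)"
proof -
  interpret prob_space "cgauss v" by (rule prob_space_cgauss[OF assms])
  \<comment> \<open>symmetry and the parallelogram law remove the cross term without an integrability argument\<close>
  let ?I = "\<integral>\<^sup>+z. ennreal ((cmod (u + c * z))\<^sup>2) \<partial>cgauss v"
  have "(\<integral>\<^sup>+z. ennreal ((cmod (u - c * z))\<^sup>2) \<partial>cgauss v) = ?I"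
    using nn_integral_cgauss_uminus[of "\<lambda>z. ennreal ((cmod (u + c * z))\<^sup>2)" v] assms by simp
  then have "?I + ?I = (\<integral>\<^sup>+z. ennreal ((cmod (u + c * z))\<^sup>2) + ennreal ((cmod (u - c * z))\<^sup>2) \<partial>cgauss v)"
    by (simp add: nn_integral_add)
  also have "\<dots> = (\<integral>\<^sup>+z. ennreal (2 * (cmod u)\<^sup>2) + ennreal (2 * (cmod c)\<^sup>2) * ennreal ((cmod z)\<^sup>2) \<partial>cgauss v)"
  proof (rule nn_integral_cong)
    fix z
    have "(cmod (u + w))\<^sup>2 + (cmod (u - w))\<^sup>2 = 2 * (cmod u)\<^sup>2 + 2 * (cmod w)\<^sup>2" for w
      by (simp add: cmod_power2) (simp add: power2_eq_square algebra_simps)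
    then show "ennreal ((cmod (u + c * z))\<^sup>2) + ennreal ((cmod (u - c * z))\<^sup>2)
        = ennreal (2 * (cmod u)\<^sup>2) + ennreal (2 * (cmod c)\<^sup>2) * ennreal ((cmod z)\<^sup>2)"
      by (simp add: ennreal_mult'[symmetric] ennreal_plus[symmetric] norm_mult power_mult_distrib del: ennreal_plus)
  qed
  also have "\<dots> = ennreal (2 * (cmod u)\<^sup>2) + ennreal (2 * (cmod c)\<^sup>2) * ennreal v"
    using assms by (simp add: nn_integral_add nn_integral_cmult nn_integral_cgauss_norm_sq emeasure_space_1[simplified])
  also have "\<dots> = ennreal ((cmod u)\<^sup>2 + (cmod c)\<^sup>2 * v) + ennreal ((cmod u)\<^sup>2 + (cmod c)\<^sup>2 * v)"
    using assms by (simp add: ennreal_mult'[symmetric] ennreal_plus[symmetric] del: ennreal_plus)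
  \<comment> \<open>Cancelling 2 only uses that 2 is nonzero and finite, so finiteness of the
    integral is a result and not an assumption.\<close>
  finally have "2 * ?I = 2 * ennreal ((cmod u)\<^sup>2 + (cmod c)\<^sup>2 * v)"
    by (simp add: mult_2)
  then show ?thesis
    by (simp add: ennreal_mult_cancel_left)
qed

text \<open>Wherever it is centred, the density of \<open>cgauss v\<close> is at most its peak
  \<open>1 / (pi * v)\<close>, and this equals the density of \<open>cgauss w\<close> at
  \<open>z\<close> times the stated weight. The right side is free of \<open>c\<close>, which is
  what later removes the signal from the law of the observation.\<close>

lemma nn_integral_cgauss_shift_le:
  assumes [measurable]: "g \<in> borel_measurable borel" and v: "v > 0" and w: "w > 0"
  shows "(\<integral>\<^sup>+z. g (c + z) \<partial>cgauss v) \<le> (\<integral>\<^sup>+z. ennreal (w / v * exp ((cmod z)\<^sup>2 / w)) * g z \<partial>cgauss w)"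
proof -
  let ?\<phi> = "normal_density 0 (sqrt (v / 2))" and ?\<psi> = "normal_density 0 (sqrt (w / 2))"
  \<comment> \<open>The two pairs of arguments are unrelated because one is the shifted point and
    the other the unshifted point.\<close>
  have dens: "?\<phi> a * ?\<phi> b \<le> ?\<psi> x * ?\<psi> y * (w / v * exp ((cmod (Complex x y))\<^sup>2 / w))" for a b x y
  proof -
    have nd: "normal_density 0 (sqrt (t / 2)) x * normal_density 0 (sqrt (t / 2)) y
        = exp (- (x\<^sup>2 + y\<^sup>2) / t) / (pi * t)" if "t > 0" for t x y
    proof -
      have "sqrt (pi * t) * sqrt (pi * t) = pi * t" using that by simp
      then show ?thesis
        using that by (simp add: normal_density_def mult_exp_exp diff_divide_distrib)
    qed
    have "?\<phi> a * ?\<phi> b = exp (- (a\<^sup>2 + b\<^sup>2) / v) / (pi * v)"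
      using v by (rule nd)
    \<comment> \<open>discarding the exponential makes the bound uniform in the shift\<close>
    also have "\<dots> \<le> 1 / (pi * v)"
      using v by (intro divide_right_mono) (auto simp: divide_le_0_iff sum_power2_ge_zero simp del: minus_add_distrib)
    also have "\<dots> = ?\<psi> x * ?\<psi> y * (w / v * exp ((cmod (Complex x y))\<^sup>2 / w))"
      using v w by (simp add: nd cmod_power2 mult_exp_exp flip: add_divide_distrib)
    finally show ?thesis .
  qed
  have "(\<integral>\<^sup>+z. g (c + z) \<partial>cgauss v)
      = (\<integral>\<^sup>+a. \<integral>\<^sup>+b. ennreal (?\<phi> a * ?\<phi> b) * g (Complex (Re c + a) (Im c + b)) \<partial>lborel \<partial>lborel)"
    using v by (simp add: nn_integral_cgauss plus_complex.code)
  also have "\<dots> = (\<integral>\<^sup>+a. \<integral>\<^sup>+b. ennreal (?\<phi> (a - Re c) * ?\<phi> b) * g (Complex a (Im c + b)) \<partial>lborel \<partial>lborel)"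
    by (subst nn_integral_real_affine[where c=1 and t="- Re c"]) simp_all
  also have "\<dots> = (\<integral>\<^sup>+a. \<integral>\<^sup>+b. ennreal (?\<phi> (a - Re c) * ?\<phi> (b - Im c)) * g (Complex a b) \<partial>lborel \<partial>lborel)"
    by (rule nn_integral_cong, subst nn_integral_real_affine[where c=1 and t="- Im c"]) simp_all
  also have "\<dots> \<le> (\<integral>\<^sup>+a. \<integral>\<^sup>+b. ennreal (?\<psi> a * ?\<psi> b * (w / v * exp ((cmod (Complex a b))\<^sup>2 / w))) * g (Complex a b) \<partial>lborel \<partial>lborel)"
    by (intro nn_integral_mono mult_right_mono ennreal_leI dens) auto
  also have "\<dots> = (\<integral>\<^sup>+z. ennreal (w / v * exp ((cmod z)\<^sup>2 / w)) * g z \<partial>cgauss w)"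
    using v w by (simp add: nn_integral_cgauss ennreal_mult'[symmetric] mult.assoc[symmetric])
  finally show ?thesis .
qed

section \<open>Products of complex Gaussians\<close>

lemma product_sigma_finite_cgauss:
  assumes "v > 0"
  shows "product_sigma_finite (\<lambda>_. cgauss v)"
proof -
  interpret prob_space "cgauss v" by (rule prob_space_cgauss[OF assms])
  show ?thesis by unfold_locales
qed

lemma prob_space_PiM_cgauss:
  assumes "v > 0"
  shows "prob_space (\<Pi>\<^sub>M i\<in>I. cgauss v)"
  using prob_space_cgauss[OF assms] by (intro prob_space_PiM)

lemma sets_PiM_cgauss [measurable_cong]: "sets (\<Pi>\<^sub>M i\<in>I. cgauss v) = sets (\<Pi>\<^sub>M i\<in>I. borel)"
  by (intro sets_PiM_cong) auto

text \<open>Coordinates are integrated out one at a time; the others act as a constant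
  \<open>u\<close>, and each contributes its own variance since cross terms vanish.\<close>

lemma nn_integral_PiM_cgauss_affine_norm_sq:
  assumes "finite I" "v > 0"
  shows "(\<integral>\<^sup>+z. ennreal ((cmod (u + (\<Sum>i\<in>I. c i * z i)))\<^sup>2) \<partial>(\<Pi>\<^sub>M i\<in>I. cgauss v))
    = ennreal ((cmod u)\<^sup>2 + v * (\<Sum>i\<in>I. (cmod (c i))\<^sup>2))"
  using assms(1)
proof (induction I rule: finite_induct)
  case empty
  show ?case by (simp add: PiM_empty nn_integral_count_space_finite)
next
  case (insert k I)
  interpret product_sigma_finite "\<lambda>_. cgauss v" by (rule product_sigma_finite_cgauss[OF assms(2)])
  interpret P: prob_space "\<Pi>\<^sub>M i\<in>I. cgauss v" by (rule prob_space_PiM_cgauss[OF assms(2)])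
  let ?f = "\<lambda>z. u + (\<Sum>i\<in>I. c i * z i)"
  have "(\<integral>\<^sup>+z. ennreal ((cmod (u + (\<Sum>i\<in>insert k I. c i * z i)))\<^sup>2) \<partial>(\<Pi>\<^sub>M i\<in>insert k I. cgauss v))
      = (\<integral>\<^sup>+z. \<integral>\<^sup>+y. ennreal ((cmod (u + (\<Sum>i\<in>insert k I. c i * (z(k := y)) i)))\<^sup>2) \<partial>cgauss v \<partial>(\<Pi>\<^sub>M i\<in>I. cgauss v))"
    using insert.hyps by (intro product_nn_integral_insert) (auto simp del: fun_upd_apply)
  also have "\<dots> = (\<integral>\<^sup>+z. \<integral>\<^sup>+y. ennreal ((cmod (?f z + c k * y))\<^sup>2) \<partial>cgauss v \<partial>(\<Pi>\<^sub>M i\<in>I. cgauss v))"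
  proof (intro nn_integral_cong)
    fix z y
    have "(\<Sum>i\<in>I. c i * (z(k := y)) i) = (\<Sum>i\<in>I. c i * z i)"
      using insert.hyps by (intro sum.cong) auto
    then show "ennreal ((cmod (u + (\<Sum>i\<in>insert k I. c i * (z(k := y)) i)))\<^sup>2) = ennreal ((cmod (?f z + c k * y))\<^sup>2)"
      using insert.hyps by (simp add: add_ac)
  qed
  also have "\<dots> = (\<integral>\<^sup>+z. ennreal ((cmod (?f z))\<^sup>2) + ennreal ((cmod (c k))\<^sup>2 * v) \<partial>(\<Pi>\<^sub>M i\<in>I. cgauss v))"
    using assms(2) by (simp add: nn_integral_cgauss_affine_norm_sq)
  also have "\<dots> = ennreal ((cmod u)\<^sup>2 + v * (\<Sum>i\<in>I. (cmod (c i))\<^sup>2)) + ennreal ((cmod (c k))\<^sup>2 * v)"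
    by (simp add: nn_integral_add insert.IH P.emeasure_space_1)
  also have "\<dots> = ennreal ((cmod u)\<^sup>2 + v * (\<Sum>i\<in>insert k I. (cmod (c i))\<^sup>2))"
    using insert.hyps assms(2)
    by (subst ennreal_plus[symmetric]) (auto simp: algebra_simps sum_nonneg)
  finally show ?case .
qed

text \<open>The one-dimensional bound is applied coordinate by coordinate. The induction generalises
  over \<open>g\<close>, since fixing one coordinate changes the integrand.\<close>

lemma nn_integral_PiM_cgauss_shift_le:
  assumes "finite I" and v: "v > 0" and w: "w > 0"
    and "g \<in> borel_measurable (\<Pi>\<^sub>M i\<in>I. borel)"
  shows "(\<integral>\<^sup>+n. g (\<lambda>i\<in>I. c i + n i) \<partial>(\<Pi>\<^sub>M i\<in>I. cgauss v))
    \<le> (\<integral>\<^sup>+y. (\<Prod>i\<in>I. ennreal (w / v * exp ((cmod (y i))\<^sup>2 / w))) * g y \<partial>(\<Pi>\<^sub>M i\<in>I. cgauss w))"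
  using assms(1,4)
proof (induction I arbitrary: g rule: finite_induct)
  case empty
  show ?case by (simp add: PiM_empty nn_integral_count_space_finite restrict_def)
next
  case (insert k I)
  note [measurable] = insert.prems
  interpret v: product_sigma_finite "\<lambda>_. cgauss v" by (rule product_sigma_finite_cgauss[OF v])
  interpret w: product_sigma_finite "\<lambda>_. cgauss w" by (rule product_sigma_finite_cgauss[OF w])
  interpret P: prob_space "\<Pi>\<^sub>M i\<in>I. cgauss w" by (rule prob_space_PiM_cgauss[OF w])
  define h where "h z = ennreal (w / v * exp ((cmod z)\<^sup>2 / w))" for z
  have [measurable]: "h \<in> borel_measurable borel" unfolding h_def by measurable
  \<comment> \<open>The weighted integral over the coordinates in \<open>I\<close> with coordinate
    \<open>k\<close> frozen at \<open>z\<close>. With \<open>k\<close> integrated outermost, the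
    induction hypothesis bounds the inner integral by \<open>G (c k + z)\<close>, and the
    one-dimensional bound then applies to \<open>G\<close>.\<close>
  define G where "G z = (\<integral>\<^sup>+y. (\<Prod>i\<in>I. h (y i)) * g (y(k := z)) \<partial>(\<Pi>\<^sub>M i\<in>I. cgauss w))" for z
  have upd [measurable]: "(\<lambda>p. (snd p)(k := fst p)) \<in> measurable (borel \<Otimes>\<^sub>M (\<Pi>\<^sub>M i\<in>I. borel)) (\<Pi>\<^sub>M i\<in>insert k I. borel)"
    by (rule measurable_fun_upd[where J=I]) auto
  have [measurable]: "G \<in> borel_measurable borel"
    unfolding G_def by measurable
  have "(\<integral>\<^sup>+n. g (\<lambda>i\<in>insert k I. c i + n i) \<partial>(\<Pi>\<^sub>M i\<in>insert k I. cgauss v))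
      = (\<integral>\<^sup>+z. \<integral>\<^sup>+n. g (\<lambda>i\<in>insert k I. c i + (n(k := z)) i) \<partial>(\<Pi>\<^sub>M i\<in>I. cgauss v) \<partial>cgauss v)"
    using insert.hyps by (intro v.product_nn_integral_insert_rev) (auto simp del: fun_upd_apply)
  also have "\<dots> = (\<integral>\<^sup>+z. \<integral>\<^sup>+n. g ((\<lambda>i\<in>I. c i + n i)(k := c k + z)) \<partial>(\<Pi>\<^sub>M i\<in>I. cgauss v) \<partial>cgauss v)"
    using insert.hyps by (intro nn_integral_cong arg_cong[where f=g]) (auto simp: fun_eq_iff)
  also have "\<dots> \<le> (\<integral>\<^sup>+z. G (c k + z) \<partial>cgauss v)"
    unfolding G_def h_def
  proof (intro nn_integral_mono insert.IH)
    fix z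
    show "(\<lambda>y. g (y(k := c k + z))) \<in> borel_measurable (\<Pi>\<^sub>M i\<in>I. borel)"
      by (rule measurable_compose[OF measurable_fun_upd[where J=I] insert.prems]) auto
  qed
  also have "\<dots> \<le> (\<integral>\<^sup>+z. h z * G z \<partial>cgauss w)"
    unfolding h_def using v w by (intro nn_integral_cgauss_shift_le) auto
  also have "\<dots> = (\<integral>\<^sup>+z. \<integral>\<^sup>+y. (\<Prod>i\<in>insert k I. h ((y(k := z)) i)) * g (y(k := z)) \<partial>(\<Pi>\<^sub>M i\<in>I. cgauss w) \<partial>cgauss w)"
  proof (rule nn_integral_cong)
    fix z
    have *: "(\<Prod>i\<in>insert k I. h ((y(k := z)) i)) = h z * (\<Prod>i\<in>I. h (y i))" for y
    proof -
      have "(\<Prod>i\<in>I. h ((y(k := z)) i)) = (\<Prod>i\<in>I. h (y i))"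
        using insert.hyps by (intro prod.cong) auto
      then show ?thesis using insert.hyps by simp
    qed
    have [measurable]: "(\<lambda>y. g (y(k := z))) \<in> borel_measurable (\<Pi>\<^sub>M i\<in>I. borel)"
      by (rule measurable_compose[OF measurable_fun_upd[where J=I] insert.prems]) auto
    show "h z * G z = (\<integral>\<^sup>+y. (\<Prod>i\<in>insert k I. h ((y(k := z)) i)) * g (y(k := z)) \<partial>(\<Pi>\<^sub>M i\<in>I. cgauss w))"
      unfolding G_def * mult.assoc by (rule nn_integral_cmult[symmetric]) measurable
  qed
  also have "\<dots> = (\<integral>\<^sup>+y. (\<Prod>i\<in>insert k I. h (y i)) * g y \<partial>(\<Pi>\<^sub>M i\<in>insert k I. cgauss w))"
    using insert.hyps by (intro w.product_nn_integral_insert_rev[symmetric]) (auto simp del: fun_upd_apply)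
  finally show ?case unfolding h_def .
qed

section \<open>The observation\<close>

lemma measurable_observe [measurable]:
  "(\<lambda>(A, n). observe N M A x n) \<in> measurable
    ((\<Pi>\<^sub>M ij\<in>{..<N} \<times> {..<M}. borel) \<Otimes>\<^sub>M (\<Pi>\<^sub>M i\<in>{..<N}. borel)) (\<Pi>\<^sub>M i\<in>{..<N}. borel)"
  unfolding observe_def by measurable

text \<open>For fixed \<open>A\<close> the noise adds \<nu> squared to each coordinate; averaging
  over \<open>A\<close> then turns each squared entry of the product of \<open>A\<close> and
  \<open>x\<close> into the power of \<open>x\<close>.\<close>

lemma nn_integral_observe_norm_sq:
  assumes "\<nu> > 0"
  shows "(\<integral>\<^sup>+A. \<integral>\<^sup>+n. ennreal (\<Sum>i<N. (cmod (observe N M A x n i))\<^sup>2) \<partial>gauss_noise \<nu> N \<partial>gauss_matrix N M)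
    = ennreal (N * ((\<Sum>j<M. (cmod (x j))\<^sup>2) + \<nu>\<^sup>2))"
proof -
  interpret G: prob_space "gauss_matrix N M"
    unfolding gauss_matrix_def by (rule prob_space_PiM_cgauss) simp
  have [measurable_cong]: "sets (gauss_noise \<nu> N) = sets (\<Pi>\<^sub>M i\<in>{..<N}. borel)"
    "sets (gauss_matrix N M) = sets (\<Pi>\<^sub>M ij\<in>{..<N} \<times> {..<M}. borel)"
    unfolding gauss_noise_def gauss_matrix_def by (rule sets_PiM_cgauss)+
  interpret W: prob_space "gauss_noise \<nu> N"
    unfolding gauss_noise_def by (rule prob_space_PiM_cgauss) (use assms in simp)
  have noise: "(\<integral>\<^sup>+n. ennreal ((cmod (u + n i))\<^sup>2) \<partial>gauss_noise \<nu> N) = ennreal ((cmod u)\<^sup>2 + \<nu>\<^sup>2)"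
    if "i < N" for u i
  proof -
    \<comment> \<open>Indicator coefficients present a single noise coordinate as a linear form, so
      that the general second-moment formula applies; the same device selects row \<open>i\<close>
      of \<open>A\<close> below.\<close>
    have 1: "(\<Sum>k<N. (if k = i then 1 else 0) * n k) = n i" for n :: "nat \<Rightarrow> complex"
      using that by (simp add: if_distrib[of "\<lambda>c. c * _"] cong: if_cong)
    have 2: "(\<Sum>k<N. (cmod (if k = i then 1 else 0))\<^sup>2) = 1"
      using that by (simp add: if_distrib[of "\<lambda>c. (cmod c)\<^sup>2"] cong: if_cong)
    show ?thesis
      using nn_integral_PiM_cgauss_affine_norm_sq[of "{..<N}" "\<nu>\<^sup>2" u "\<lambda>k. if k = i then 1 else 0"] assms
      unfolding gauss_noise_def 1 2 by simp
  qed
  have mat: "(\<integral>\<^sup>+A. ennreal ((cmod (\<Sum>j<M. A (i, j) * x j))\<^sup>2) \<partial>gauss_matrix N M)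
      = ennreal (\<Sum>j<M. (cmod (x j))\<^sup>2)" if "i < N" for i
  proof -
    have 1: "(\<Sum>p\<in>{..<N} \<times> {..<M}. (if fst p = i then x (snd p) else 0) * A p) = (\<Sum>j<M. A (i, j) * x j)" for A
    proof -
      have "(\<Sum>p\<in>{..<N} \<times> {..<M}. (if fst p = i then x (snd p) else 0) * A p)
          = (\<Sum>k<N. if k = i then (\<Sum>j<M. A (k, j) * x j) else 0)"
        unfolding sum.cartesian_product' by (intro sum.cong) (auto simp: mult.commute)
      then show ?thesis using that by simp
    qed
    have 2: "(\<Sum>p\<in>{..<N} \<times> {..<M}. (cmod (if fst p = i then x (snd p) else 0))\<^sup>2) = (\<Sum>j<M. (cmod (x j))\<^sup>2)"
    proof -
      have "(\<Sum>p\<in>{..<N} \<times> {..<M}. (cmod (if fst p = i then x (snd p) else 0))\<^sup>2)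
          = (\<Sum>k<N. if k = i then (\<Sum>j<M. (cmod (x j))\<^sup>2) else 0)"
        unfolding sum.cartesian_product' by (intro sum.cong) auto
      then show ?thesis using that by simp
    qed
    show ?thesis
      using nn_integral_PiM_cgauss_affine_norm_sq[of "{..<N} \<times> {..<M}" 1 0 "\<lambda>p. if fst p = i then x (snd p) else 0"]
      unfolding gauss_matrix_def 1 2 by simp
  qed
  have "(\<integral>\<^sup>+A. \<integral>\<^sup>+n. ennreal (\<Sum>i<N. (cmod (observe N M A x n i))\<^sup>2) \<partial>gauss_noise \<nu> N \<partial>gauss_matrix N M)
      = (\<integral>\<^sup>+A. (\<Sum>i<N. ennreal ((cmod (\<Sum>j<M. A (i, j) * x j))\<^sup>2 + \<nu>\<^sup>2)) \<partial>gauss_matrix N M)"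
    by (rule nn_integral_cong) (simp add: observe_def nn_integral_sum noise flip: sum_ennreal)
  also have "\<dots> = (\<Sum>i<N. \<integral>\<^sup>+A. ennreal ((cmod (\<Sum>j<M. A (i, j) * x j))\<^sup>2) + ennreal (\<nu>\<^sup>2) \<partial>gauss_matrix N M)"
    by (subst nn_integral_sum) auto
  also have "\<dots> = (\<Sum>i<N. ennreal ((\<Sum>j<M. (cmod (x j))\<^sup>2) + \<nu>\<^sup>2))"
    by (intro sum.cong) (auto simp: nn_integral_add mat G.emeasure_space_1 sum_nonneg)
  also have "\<dots> = ennreal (N * ((\<Sum>j<M. (cmod (x j))\<^sup>2) + \<nu>\<^sup>2))"
    by (simp add: sum_nonneg ennreal_mult ennreal_of_nat_eq_real_of_nat)
  finally show ?thesis .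
qed

section \<open>Change of measure for the success event\<close>

text \<open>The density weight is unbounded, so \<open>S\<close> is cut by the ball of squared
  radius \<open>R\<close>: outside it Markov's inequality applies, inside it the weight is at most
  \<open>(w / v) ^ card I * exp (R / w)\<close>.\<close>

lemma emeasure_shift_le:
  assumes S [measurable]: "S \<in> sets (\<Pi>\<^sub>M i\<in>I. borel)" and "finite I" and v: "v > 0" and w: "w > 0" and "R > 0"
  shows "emeasure (\<Pi>\<^sub>M i\<in>I. cgauss v) {n \<in> space (\<Pi>\<^sub>M i\<in>I. cgauss v). (\<lambda>i\<in>I. c i + n i) \<in> S}
    \<le> ennreal (1 / R) * (\<integral>\<^sup>+n. ennreal (\<Sum>i\<in>I. (cmod (c i + n i))\<^sup>2) \<partial>(\<Pi>\<^sub>M i\<in>I. cgauss v))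
      + ennreal ((w / v) ^ card I * exp (R / w)) * emeasure (\<Pi>\<^sub>M i\<in>I. cgauss w) S"
proof -
  let ?V = "\<Pi>\<^sub>M i\<in>I. cgauss v" and ?W = "\<Pi>\<^sub>M i\<in>I. cgauss w"
  let ?y = "\<lambda>n. \<lambda>i\<in>I. c i + n i"
  define B where "B = {y \<in> space (\<Pi>\<^sub>M i\<in>I. (borel :: complex measure)). (\<Sum>i\<in>I. (cmod (y i))\<^sup>2) \<le> R}"
  have B [measurable]: "B \<in> sets (\<Pi>\<^sub>M i\<in>I. borel)" unfolding B_def by measurable
  have [measurable]: "?y \<in> measurable (\<Pi>\<^sub>M i\<in>I. borel) (\<Pi>\<^sub>M i\<in>I. borel)" by measurable
  have "(\<integral>\<^sup>+n. indicator (S \<inter> B) (?y n) \<partial>?V)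
      \<le> (\<integral>\<^sup>+y. (\<Prod>i\<in>I. ennreal (w / v * exp ((cmod (y i))\<^sup>2 / w))) * indicator (S \<inter> B) y \<partial>?W)"
    using assms by (intro nn_integral_PiM_cgauss_shift_le) auto
  also have "\<dots> \<le> (\<integral>\<^sup>+y. ennreal ((w / v) ^ card I * exp (R / w)) * indicator S y \<partial>?W)"
  proof (rule nn_integral_mono)
    fix y
    have "(\<Prod>i\<in>I. w / v * exp ((cmod (y i))\<^sup>2 / w)) \<le> (w / v) ^ card I * exp (R / w)" if "y \<in> B"
    proof -
      have "(\<Prod>i\<in>I. w / v * exp ((cmod (y i))\<^sup>2 / w)) = (w / v) ^ card I * exp ((\<Sum>i\<in>I. (cmod (y i))\<^sup>2) / w)"
        using \<open>finite I\<close> by (simp only: prod.distrib prod_constant exp_sum[symmetric] sum_divide_distrib)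
      then show ?thesis
        using that v w by (auto intro!: mult_left_mono divide_right_mono simp: B_def)
    qed
    then show "(\<Prod>i\<in>I. ennreal (w / v * exp ((cmod (y i))\<^sup>2 / w))) * indicator (S \<inter> B) y
        \<le> ennreal ((w / v) ^ card I * exp (R / w)) * indicator S y"
      using v w by (auto simp: indicator_def prod_ennreal ennreal_leI)
  qed
  also have "\<dots> = ennreal ((w / v) ^ card I * exp (R / w)) * emeasure ?W S"
    by (subst nn_integral_cmult_indicator) auto
  finally have tail: "(\<integral>\<^sup>+n. indicator (S \<inter> B) (?y n) \<partial>?V)
      \<le> ennreal ((w / v) ^ card I * exp (R / w)) * emeasure ?W S" .
  have "emeasure ?V {n \<in> space ?V. ?y n \<in> S} = (\<integral>\<^sup>+n. indicator {n \<in> space ?V. ?y n \<in> S} n \<partial>?V)"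
    by (rule nn_integral_indicator[symmetric]) measurable
  also have "\<dots> = (\<integral>\<^sup>+n. indicator S (?y n) \<partial>?V)"
    by (intro nn_integral_cong) (auto simp: indicator_def)
  \<comment> \<open>A pointwise form of Markov's inequality: off the ball the first summand alone is
    at least 1.\<close>
  also have "\<dots> \<le> (\<integral>\<^sup>+n. ennreal (1 / R) * ennreal (\<Sum>i\<in>I. (cmod (c i + n i))\<^sup>2) + indicator (S \<inter> B) (?y n) \<partial>?V)"
  proof (rule nn_integral_mono)
    fix n
    have "1 \<le> ennreal (1 / R) * ennreal (\<Sum>i\<in>I. (cmod (c i + n i))\<^sup>2)" if "?y n \<in> S" "?y n \<notin> B"
    proof -
      have "?y n \<in> space (\<Pi>\<^sub>M i\<in>I. (borel :: complex measure))"
        by (simp add: space_PiM)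
      then have "R < (\<Sum>i\<in>I. (cmod (c i + n i))\<^sup>2)" using that by (simp add: B_def)
      then have "1 \<le> 1 / R * (\<Sum>i\<in>I. (cmod (c i + n i))\<^sup>2)" using \<open>R > 0\<close> by (simp add: field_simps)
      then show ?thesis using \<open>R > 0\<close> by (simp flip: ennreal_mult')
    qed
    then show "indicator S (?y n) \<le> ennreal (1 / R) * ennreal (\<Sum>i\<in>I. (cmod (c i + n i))\<^sup>2) + indicator (S \<inter> B) (?y n)"
      by (auto simp: indicator_def)
  qed
  also have "\<dots> = ennreal (1 / R) * (\<integral>\<^sup>+n. ennreal (\<Sum>i\<in>I. (cmod (c i + n i))\<^sup>2) \<partial>?V) + (\<integral>\<^sup>+n. indicator (S \<inter> B) (?y n) \<partial>?V)"
    by (subst nn_integral_add, measurable) (simp add: nn_integral_cmult)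
  also have "\<dots> \<le> ennreal (1 / R) * (\<integral>\<^sup>+n. ennreal (\<Sum>i\<in>I. (cmod (c i + n i))\<^sup>2) \<partial>?V)
      + ennreal ((w / v) ^ card I * exp (R / w)) * emeasure ?W S"
    by (intro add_left_mono tail)
  finally show ?thesis .
qed

lemma pred_success_decoder:
  assumes "decoder N M L D"
  shows "Measurable.pred ((\<Pi>\<^sub>M ij\<in>{..<N} \<times> {..<M}. borel) \<Otimes>\<^sub>M (\<Pi>\<^sub>M i\<in>{..<N}. borel))
    (\<lambda>p. success2 \<alpha> I (D (fst p) (snd p)))"
proof -
  have "(\<lambda>p. success2 \<alpha> I (case_prod D p)) \<in> measurable
      ((\<Pi>\<^sub>M ij\<in>{..<N} \<times> {..<M}. borel) \<Otimes>\<^sub>M (\<Pi>\<^sub>M i\<in>{..<N}. borel)) (count_space UNIV)"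
    using assms unfolding decoder_def by (rule measurable_compose) simp
  then show ?thesis by (simp add: split_beta)
qed

text \<open>The cut is made at \<open>R = 2 * N * w\<close>, twice the mean squared norm of the
  observation, so Markov's inequality costs exactly 1/2 and \<open>exp (R / w)\<close> becomes
  \<open>exp 2 ^ N\<close>. On the right \<open>x\<close> enters only through its power and its
  support, and \<open>y\<close> is drawn independently of \<open>A\<close>.\<close>

lemma one_minus_p_err_le:
  fixes \<nu> :: real and x :: "nat \<Rightarrow> complex" and N M :: nat
  defines "w \<equiv> (\<Sum>j<M. (cmod (x j))\<^sup>2) + \<nu>\<^sup>2"
  assumes D: "decoder N M L D" and \<nu>: "\<nu> > 0" and N: "N \<ge> 1"
  shows "ennreal (1 - p_err \<alpha> \<nu> N M D x) \<le> ennreal (1 / 2) + ennreal ((w / \<nu>\<^sup>2 * exp 2) ^ N) *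
    (\<integral>\<^sup>+A. emeasure (\<Pi>\<^sub>M i\<in>{..<N}. cgauss w)
      {y \<in> space (\<Pi>\<^sub>M i\<in>{..<N}. cgauss w). success2 \<alpha> (supp M x) (D A y)} \<partial>gauss_matrix N M)"
    (is "_ \<le> _ + _ * (\<integral>\<^sup>+A. emeasure ?Q (?S A) \<partial>?G)")
proof -
  let ?W = "gauss_noise \<nu> N"
  let ?s = "\<lambda>A n. success2 \<alpha> (supp M x) (D A (observe N M A x n))"
  have w: "w > 0" unfolding w_def using \<nu> by (intro add_nonneg_pos sum_nonneg) auto
  have [measurable_cong]: "sets ?W = sets (\<Pi>\<^sub>M i\<in>{..<N}. borel)"
    "sets ?G = sets (\<Pi>\<^sub>M ij\<in>{..<N} \<times> {..<M}. borel)"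
    unfolding gauss_noise_def gauss_matrix_def by (rule sets_PiM_cgauss)+
  interpret G: prob_space ?G
    unfolding gauss_matrix_def by (rule prob_space_PiM_cgauss) simp
  interpret W: prob_space ?W
    unfolding gauss_noise_def by (rule prob_space_PiM_cgauss) (use \<nu> in simp)
  interpret Q: prob_space ?Q by (rule prob_space_PiM_cgauss[OF w])
  note succ [measurable] = pred_success_decoder[OF D, of \<alpha> "supp M x"]
  have pair [measurable]: "(\<lambda>p. (fst p, observe N M (fst p) x (snd p))) \<in> measurable (?G \<Otimes>\<^sub>M ?W)
      ((\<Pi>\<^sub>M ij\<in>{..<N} \<times> {..<M}. borel) \<Otimes>\<^sub>M (\<Pi>\<^sub>M i\<in>{..<N}. borel))"
    using measurable_observe[of N M x] by (auto simp: split_beta intro!: measurable_Pair)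
  have ps [measurable]: "Measurable.pred (?G \<Otimes>\<^sub>M ?W) (\<lambda>p. ?s (fst p) (snd p))"
    using measurable_compose[OF pair succ] by simp
  have s [measurable]: "Measurable.pred ?W (?s A)" if "A \<in> space ?G" for A
    using measurable_compose[OF measurable_Pair1'[OF that] ps] by simp
  define f where "f A = measure ?W {n \<in> space ?W. ?s A n}" for A
  have emeasure_f: "emeasure ?W {n \<in> space ?W. ?s A n} = ennreal (f A)" for A
    unfolding f_def by (rule W.emeasure_eq_measure)
  have f01: "0 \<le> f A" "f A \<le> 1" for A unfolding f_def by simp_all
  \<comment> \<open>Measurability of \<open>f\<close> is obtained from that of a parametrised
    integral of a jointly measurable indicator.\<close>
  have "(\<lambda>A. \<integral>\<^sup>+n. indicator {p. ?s (fst p) (snd p)} (A, n) \<partial>?W) \<in> borel_measurable ?G"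
    by measurable
  moreover have "f A = enn2real (\<integral>\<^sup>+n. indicator {p. ?s (fst p) (snd p)} (A, n) \<partial>?W)" if "A \<in> space ?G" for A
  proof -
    have "(\<integral>\<^sup>+n. indicator {p. ?s (fst p) (snd p)} (A, n) \<partial>?W)
        = (\<integral>\<^sup>+n. indicator {n \<in> space ?W. ?s A n} n \<partial>?W)"
      by (intro nn_integral_cong) (simp add: indicator_def)
    also have "\<dots> = emeasure ?W {n \<in> space ?W. ?s A n}"
      using s[OF that] by (intro nn_integral_indicator) simp
    finally show ?thesis by (simp add: emeasure_f f01)
  qed
  ultimately have f [measurable]: "f \<in> borel_measurable ?G"
    by (simp cong: measurable_cong)
  \<comment> \<open>Integrability permits splitting the Bochner integral of \<open>1 - f\<close> and
    passing to a nonnegative integral.\<close>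
  have int_f: "integrable ?G f"
    using f01 by (intro G.integrable_const_bound[where B=1]) auto
  have "p_err \<alpha> \<nu> N M D x = (\<integral>A. 1 - f A \<partial>?G)"
    unfolding p_err_def
  proof (rule Bochner_Integration.integral_cong)
    fix A assume "A \<in> space ?G"
    then show "p_err_given \<alpha> \<nu> N M D A x = 1 - f A"
      unfolding p_err_given_def f_def using W.prob_neg[of "?s A"] s by simp
  qed simp
  then have "1 - p_err \<alpha> \<nu> N M D x = (\<integral>A. f A \<partial>?G)"
    using int_f by (simp add: G.prob_space)
  then have "ennreal (1 - p_err \<alpha> \<nu> N M D x) = (\<integral>\<^sup>+A. emeasure ?W {n \<in> space ?W. ?s A n} \<partial>?G)"
    using nn_integral_eq_integral[OF int_f] f01 by (simp add: emeasure_f)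
  also have "\<dots> \<le> (\<integral>\<^sup>+A. ennreal (1 / (2 * N * w)) * (\<integral>\<^sup>+n. ennreal (\<Sum>i<N. (cmod (observe N M A x n i))\<^sup>2) \<partial>?W)
      + ennreal ((w / \<nu>\<^sup>2 * exp 2) ^ N) * emeasure ?Q (?S A) \<partial>?G)"
  proof (rule nn_integral_mono)
    fix A assume A: "A \<in> space ?G"
    then have A': "A \<in> space (\<Pi>\<^sub>M ij\<in>{..<N} \<times> {..<M}. (borel :: complex measure))"
      by (simp add: gauss_matrix_def space_PiM)
    have S: "?S A \<in> sets (\<Pi>\<^sub>M i\<in>{..<N}. borel)"
    proof -
      have "{y \<in> space (\<Pi>\<^sub>M i\<in>{..<N}. borel). success2 \<alpha> (supp M x) (D A y)} \<in> sets (\<Pi>\<^sub>M i\<in>{..<N}. borel)"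
        using measurable_compose[OF measurable_Pair1'[OF A'] succ] by simp
      then show ?thesis by (simp add: space_PiM)
    qed
    have mem: "(\<lambda>i\<in>{..<N}. u i + n i) \<in> space ?Q" for u n
      by (simp add: space_PiM)
    have "exp (2 * N * w / w) = exp 2 ^ N"
      using w by (simp flip: exp_of_nat_mult add: mult.commute)
    moreover have "2 * real N * w > 0" using N w by simp
    ultimately show "emeasure ?W {n \<in> space ?W. ?s A n}
        \<le> ennreal (1 / (2 * N * w)) * (\<integral>\<^sup>+n. ennreal (\<Sum>i<N. (cmod (observe N M A x n i))\<^sup>2) \<partial>?W)
          + ennreal ((w / \<nu>\<^sup>2 * exp 2) ^ N) * emeasure ?Q (?S A)"
      using emeasure_shift_le[OF S finite_lessThan _ w, of "\<nu>\<^sup>2" "2 * N * w" "\<lambda>i. \<Sum>j<M. A (i, j) * x j"] \<nu> w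
      by (simp add: gauss_noise_def mem observe_def power_mult_distrib power_divide)
  qed
  also have "\<dots> = ennreal (1 / (2 * N * w)) * ennreal (N * w)
      + ennreal ((w / \<nu>\<^sup>2 * exp 2) ^ N) * (\<integral>\<^sup>+A. emeasure ?Q (?S A) \<partial>?G)"
  proof -
    have "(\<lambda>A. \<integral>\<^sup>+n. ennreal (\<Sum>i<N. (cmod (observe N M A x n i))\<^sup>2) \<partial>?W) \<in> borel_measurable ?G"
    proof -
      have "(\<Sum>i<N. (cmod (observe N M A x n i))\<^sup>2) = (\<Sum>i<N. (cmod ((\<Sum>j<M. A (i, j) * x j) + n i))\<^sup>2)" for A n
        by (simp add: observe_def)
      then show ?thesis by simp
    qed
    moreover have "(\<lambda>A. emeasure ?Q (?S A)) \<in> borel_measurable ?G"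
      by measurable
    ultimately show ?thesis
      using nn_integral_observe_norm_sq[OF \<nu>, of N M x]
      by (simp add: nn_integral_add nn_integral_cmult w_def)
  qed
  also have "ennreal (1 / (2 * N * w)) * ennreal (N * w) = ennreal (1 / 2)"
    using N w by (subst ennreal_mult'[symmetric]) auto
  finally show ?thesis .
qed

section \<open>Averaging over relabellings\<close>

text \<open>Relabelling preserves the power, so one reference measure serves all \<pi> and the
  average over \<pi> can be moved inside the integrals over \<open>A\<close> and \<open>y\<close>.
  There the decoded set is fixed while the support is uniformly random, and the Chernoff bound
  applies.\<close>

lemma p_err_unknown_ge:
  fixes \<nu> s P :: real and x :: "nat \<Rightarrow> complex" and N M L :: nat
  assumes D: "decoder N M L D" and \<nu>: "\<nu> > 0" and N: "N \<ge> 1" and s: "s > 0" and L: "L > 0"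
    and card: "card (supp M x) = L" and P: "(\<Sum>j<M. (cmod (x j))\<^sup>2) = P"
  shows "p_err_unknown \<alpha> \<nu> N M D x \<ge> 1 / 2 -
    ((P + \<nu>\<^sup>2) / \<nu>\<^sup>2 * exp 2) ^ N * ((1 + s * (L / M)) / (1 + s) powr (1 - \<alpha>)) ^ L"
proof -
  define w where "w = P + \<nu>\<^sup>2"
  define K where "K = (w / \<nu>\<^sup>2 * exp 2) ^ N"
  define \<tau> where "\<tau> = ((1 + s * (L / M)) / (1 + s) powr (1 - \<alpha>)) ^ L"
  let ?\<Pi> = "{\<pi>. \<pi> permutes {..<M}}"
  let ?G = "gauss_matrix N M" and ?Q = "\<Pi>\<^sub>M i\<in>{..<N}. cgauss w"
  let ?S = "\<lambda>\<pi> A. {y \<in> space ?Q. success2 \<alpha> (supp M (x \<circ> \<pi>)) (D A y)}"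
  have "P \<ge> 0" unfolding P[symmetric] by (simp add: sum_nonneg)
  then have w: "w > 0" using \<nu> by (simp add: w_def add_nonneg_pos)
  have K: "K \<ge> 0" using w by (simp add: K_def)
  have \<tau>: "\<tau> \<ge> 0" using s by (simp add: \<tau>_def)
  have [measurable_cong]: "sets ?G = sets (\<Pi>\<^sub>M ij\<in>{..<N} \<times> {..<M}. borel)"
    unfolding gauss_matrix_def by (rule sets_PiM_cgauss)
  interpret G: prob_space ?G
    unfolding gauss_matrix_def by (rule prob_space_PiM_cgauss) simp
  interpret Q: prob_space ?Q by (rule prob_space_PiM_cgauss[OF w])
  have fin: "finite ?\<Pi>" by (rule finite_permutations) simp
  have overlap: "(\<Sum>\<pi>\<in>?\<Pi>. of_bool (success2 \<alpha> (supp M (x \<circ> \<pi>)) J)) \<le> fact M * \<tau>"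
    if "J \<subseteq> {..<M}" "card J = L" for J
  proof -
    \<comment> \<open>The support of \<open>x \<circ> \<pi>\<close> is the preimage of the support
      of \<open>x\<close>, so the overlap counts the indices of \<open>J\<close> that \<pi> sends
      into the latter.\<close>
    have "success2 \<alpha> (supp M (x \<circ> \<pi>)) J \<longleftrightarrow> real (card {i\<in>J. \<pi> i \<in> supp M x}) > (1 - \<alpha>) * L"
      if \<pi>: "\<pi> permutes {..<M}" for \<pi>
    proof -
      have lt: "\<pi> i < M \<longleftrightarrow> i < M" for i
        using permutes_in_image[OF \<pi>, of i] by simp
      have "supp M (x \<circ> \<pi>) = \<pi> -` supp M x"
        by (auto simp: supp_def lt)
      then have "card (supp M (x \<circ> \<pi>)) = L"
        using card card_vimage_inj[OF permutes_inj[OF \<pi>], of "supp M x"] permutes_surj[OF \<pi>] by simp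
      moreover have "J \<inter> supp M (x \<circ> \<pi>) = {i\<in>J. \<pi> i \<in> supp M x}"
        by (auto simp: supp_def lt)
      ultimately show ?thesis using L by (simp add: success2_def field_simps)
    qed
    then have "(\<Sum>\<pi>\<in>?\<Pi>. of_bool (success2 \<alpha> (supp M (x \<circ> \<pi>)) J))
        = real (card {\<pi>. \<pi> permutes {..<M} \<and> real (card {i\<in>J. \<pi> i \<in> supp M x}) > (1 - \<alpha>) * L})"
      using fin by (simp add: Int_def cong: conj_cong)
    also have "\<dots> \<le> fact M * ((1 + s * (card (supp M x) / card {..<M})) ^ card J / (1 + s) powr ((1 - \<alpha>) * L))"
      using card_permutes_large_overlap_le[of "{..<M}" J "supp M x" s "(1 - \<alpha>) * L"] that s
      by (auto simp: supp_def)
    also have "\<dots> = fact M * \<tau>"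
      using s by (simp add: \<tau>_def that card power_divide powr_realpow[symmetric] powr_powr)
    finally show ?thesis .
  qed
  have "(\<Sum>\<pi>\<in>?\<Pi>. ennreal (1 - p_err \<alpha> \<nu> N M D (x \<circ> \<pi>)))
      \<le> (\<Sum>\<pi>\<in>?\<Pi>. ennreal (1 / 2) + ennreal K * (\<integral>\<^sup>+A. emeasure ?Q (?S \<pi> A) \<partial>?G))"
  proof (rule sum_mono)
    fix \<pi> assume "\<pi> \<in> ?\<Pi>"
    then have "(\<Sum>j<M. (cmod ((x \<circ> \<pi>) j))\<^sup>2) = P"
      using sum.permute[of \<pi> "{..<M}" "\<lambda>j. (cmod (x j))\<^sup>2"] P by (simp add: o_def)
    then show "ennreal (1 - p_err \<alpha> \<nu> N M D (x \<circ> \<pi>))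
        \<le> ennreal (1 / 2) + ennreal K * (\<integral>\<^sup>+A. emeasure ?Q (?S \<pi> A) \<partial>?G)"
      using one_minus_p_err_le[OF D \<nu> N, where x="x \<circ> \<pi>" and \<alpha>=\<alpha>] by (simp add: w_def K_def)
  qed
  also have "\<dots> = ennreal (fact M / 2) + ennreal K * (\<integral>\<^sup>+A. (\<Sum>\<pi>\<in>?\<Pi>. emeasure ?Q (?S \<pi> A)) \<partial>?G)"
  proof -
    have "(\<lambda>A. emeasure ?Q (?S \<pi> A)) \<in> borel_measurable ?G" for \<pi>
    proof -
      note [measurable] = pred_success_decoder[OF D, of \<alpha> "supp M (x \<circ> \<pi>)"]
      show ?thesis by measurable
    qed
    then have "(\<integral>\<^sup>+A. (\<Sum>\<pi>\<in>?\<Pi>. emeasure ?Q (?S \<pi> A)) \<partial>?G) = (\<Sum>\<pi>\<in>?\<Pi>. \<integral>\<^sup>+A. emeasure ?Q (?S \<pi> A) \<partial>?G)"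
      by (rule nn_integral_sum)
    moreover have "(\<Sum>\<pi>\<in>?\<Pi>. ennreal (1 / 2)) = ennreal (fact M / 2)"
      by (subst sum_ennreal) (auto simp: card_permutations)
    ultimately show ?thesis
      by (simp only: sum.distrib sum_distrib_left)
  qed
  also have "(\<integral>\<^sup>+A. (\<Sum>\<pi>\<in>?\<Pi>. emeasure ?Q (?S \<pi> A)) \<partial>?G) \<le> (\<integral>\<^sup>+A. ennreal (fact M * \<tau>) \<partial>?G)"
  proof (rule nn_integral_mono)
    fix A assume "A \<in> space ?G"
    then have A: "A \<in> space (\<Pi>\<^sub>M ij\<in>{..<N} \<times> {..<M}. (borel :: complex measure))"
      by (simp add: gauss_matrix_def space_PiM)
    have S: "?S \<pi> A \<in> sets ?Q" for \<pi>
    proof -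
      have "{y \<in> space (\<Pi>\<^sub>M i\<in>{..<N}. borel). success2 \<alpha> (supp M (x \<circ> \<pi>)) (D A y)} \<in> sets (\<Pi>\<^sub>M i\<in>{..<N}. borel)"
        using measurable_compose[OF measurable_Pair1'[OF A] pred_success_decoder[OF D]] by simp
      then show ?thesis by (simp add: space_PiM sets_PiM_cgauss)
    qed
    have "(\<Sum>\<pi>\<in>?\<Pi>. emeasure ?Q (?S \<pi> A)) = (\<integral>\<^sup>+y. (\<Sum>\<pi>\<in>?\<Pi>. indicator (?S \<pi> A) y) \<partial>?Q)"
      using S by (subst nn_integral_sum) auto
    also have "\<dots> \<le> (\<integral>\<^sup>+y. ennreal (fact M * \<tau>) \<partial>?Q)"
    proof (rule nn_integral_mono)
      fix y assume y: "y \<in> space ?Q"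
      then have "y \<in> space (\<Pi>\<^sub>M i\<in>{..<N}. (borel :: complex measure))" by (simp add: space_PiM)
      with A have "(A, y) \<in> space ((\<Pi>\<^sub>M ij\<in>{..<N} \<times> {..<M}. (borel :: complex measure)) \<Otimes>\<^sub>M (\<Pi>\<^sub>M i\<in>{..<N}. (borel :: complex measure)))"
        by (simp add: space_pair_measure)
      \<comment> \<open>That the decoded set is an admissible set of size \<open>L\<close> is
        contained in the codomain of the measurability condition.\<close>
      from measurable_space[OF D[unfolded decoder_def] this]
      have "D A y \<subseteq> {..<M}" "card (D A y) = L" by auto
      then have "ennreal (\<Sum>\<pi>\<in>?\<Pi>. of_bool (success2 \<alpha> (supp M (x \<circ> \<pi>)) (D A y))) \<le> ennreal (fact M * \<tau>)"
        by (intro ennreal_leI overlap)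
      moreover have "(\<Sum>\<pi>\<in>?\<Pi>. indicator (?S \<pi> A) y)
          = ennreal (\<Sum>\<pi>\<in>?\<Pi>. of_bool (success2 \<alpha> (supp M (x \<circ> \<pi>)) (D A y)))"
      proof -
        have "(\<Sum>\<pi>\<in>?\<Pi>. indicator (?S \<pi> A) y)
            = (\<Sum>\<pi>\<in>?\<Pi>. ennreal (of_bool (success2 \<alpha> (supp M (x \<circ> \<pi>)) (D A y))))"
          using y by (intro sum.cong) (auto simp: indicator_def)
        also have "\<dots> = ennreal (\<Sum>\<pi>\<in>?\<Pi>. of_bool (success2 \<alpha> (supp M (x \<circ> \<pi>)) (D A y)))"
          by (rule sum_ennreal) simp
        finally show ?thesis .
      qed
      ultimately show "(\<Sum>\<pi>\<in>?\<Pi>. indicator (?S \<pi> A) y) \<le> ennreal (fact M * \<tau>)" by simp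
    qed
    also have "\<dots> = ennreal (fact M * \<tau>)" by (simp add: Q.emeasure_space_1)
    finally show "(\<Sum>\<pi>\<in>?\<Pi>. emeasure ?Q (?S \<pi> A)) \<le> ennreal (fact M * \<tau>)" .
  qed
  also have "ennreal (fact M / 2) + ennreal K * (\<integral>\<^sup>+A. ennreal (fact M * \<tau>) \<partial>?G)
      = ennreal (fact M * (1 / 2 + K * \<tau>))"
    using K \<tau> by (simp add: G.emeasure_space_1 ennreal_mult'[symmetric] ennreal_plus[symmetric] algebra_simps del: ennreal_plus)
  finally have "(\<Sum>\<pi>\<in>?\<Pi>. ennreal (1 - p_err \<alpha> \<nu> N M D (x \<circ> \<pi>))) \<le> ennreal (fact M * (1 / 2 + K * \<tau>))"
    by (simp add: mult_left_mono add_left_mono)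
  moreover have "ennreal (\<Sum>\<pi>\<in>?\<Pi>. 1 - p_err \<alpha> \<nu> N M D (x \<circ> \<pi>))
      \<le> (\<Sum>\<pi>\<in>?\<Pi>. ennreal (1 - p_err \<alpha> \<nu> N M D (x \<circ> \<pi>)))"
  proof -
    \<comment> \<open>Since \<open>ennreal\<close> truncates negative reals to 0, the comparison
      goes through the positive parts.\<close>
    have "(\<Sum>\<pi>\<in>?\<Pi>. 1 - p_err \<alpha> \<nu> N M D (x \<circ> \<pi>)) \<le> (\<Sum>\<pi>\<in>?\<Pi>. max 0 (1 - p_err \<alpha> \<nu> N M D (x \<circ> \<pi>)))"
      by (intro sum_mono) auto
    then have "ennreal (\<Sum>\<pi>\<in>?\<Pi>. 1 - p_err \<alpha> \<nu> N M D (x \<circ> \<pi>))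
        \<le> ennreal (\<Sum>\<pi>\<in>?\<Pi>. max 0 (1 - p_err \<alpha> \<nu> N M D (x \<circ> \<pi>)))"
      by (rule ennreal_leI)
    then show ?thesis by (simp add: sum_ennreal[symmetric] ennreal_max_0)
  qed
  ultimately have "ennreal (\<Sum>\<pi>\<in>?\<Pi>. 1 - p_err \<alpha> \<nu> N M D (x \<circ> \<pi>)) \<le> ennreal (fact M * (1 / 2 + K * \<tau>))"
    by (rule order_trans[rotated])
  then have "(\<Sum>\<pi>\<in>?\<Pi>. 1 - p_err \<alpha> \<nu> N M D (x \<circ> \<pi>)) \<le> fact M * (1 / 2 + K * \<tau>)"
    using K \<tau> by (subst (asm) ennreal_le_iff) auto
  then have "fact M - (\<Sum>\<pi>\<in>?\<Pi>. p_err \<alpha> \<nu> N M D (x \<circ> \<pi>)) \<le> fact M * (1 / 2 + K * \<tau>)"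
    by (simp add: sum_subtractf card_permutations)
  then have "1 - p_err_unknown \<alpha> \<nu> N M D x \<le> 1 / 2 + K * \<tau>"
    by (simp add: p_err_unknown_def field_simps)
  then show ?thesis by (simp add: K_def \<tau>_def w_def)
qed

section \<open>Choice of the constant and asymptotics\<close>

theorem mainTheorem4:
  fixes \<alpha> \<beta> P \<nu> :: real
  assumes "0 < \<alpha>" and "\<alpha> < 1" and "\<beta> > 2" and "P > 0" and "\<nu> > 0"
  shows "\<exists>C4::real. C4 \<ge> 0 \<and> (\<alpha> < 1 - 1 / \<beta> \<longrightarrow> C4 > 0) \<and>
    (\<forall>(x :: nat \<Rightarrow> nat \<Rightarrow> complex) (N :: nat \<Rightarrow> nat) (L :: nat \<Rightarrow> nat).
       (\<forall>M. L M = nat \<lfloor>1 / \<beta> * real M\<rfloor>) \<longrightarrow>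
       (\<forall>M. card (supp M (x M)) = L M) \<longrightarrow>
       (\<forall>M. L M > 0 \<longrightarrow> (\<Sum>i<M. (cmod (x M i))\<^sup>2) = P) \<longrightarrow>
       (\<forall>M\<ge>1. N M \<ge> 1) \<longrightarrow>
       asymp_prec (\<lambda>M. real (N M)) (\<lambda>M. C4 * real (L M)) \<longrightarrow>
       reliable_recovery_impossible \<alpha> \<nu> N L x)"
proof (cases "\<alpha> < 1 - 1 / \<beta>")
  case False
  \<comment> \<open>Both alternatives of \<open>asymp_succ\<close> fail: \<open>N 1\<close> is
    nonzero, and a quotient with numerator 0 never exceeds 1.\<close>
  have "\<not> asymp_prec (\<lambda>M. real (N M)) (\<lambda>M. 0 * real (L M))" if "\<forall>M\<ge>1. N M \<ge> 1" for N L :: "nat \<Rightarrow> nat"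
  proof -
    have "N 1 \<noteq> 0" using that by (metis le_refl not_one_le_zero)
    then show ?thesis by (auto simp: asymp_succ_def)
  qed
  then show ?thesis using False by (intro exI[of _ 0]) blast
next
  case True
  then obtain s where s: "s > 0" "1 + s * (1 / \<beta>) < (1 + s) powr (1 - \<alpha>)"
    using exists_chernoff_parameter[of "1 / \<beta>" "1 - \<alpha>"] assms by auto
  \<comment> \<open>The decay rate per index of the support, with \<open>L / M\<close> replaced by
    its upper bound \<open>1 / \<beta>\<close>.\<close>
  define \<rho> where "\<rho> = (1 + s * (1 / \<beta>)) / (1 + s) powr (1 - \<alpha>)"
  define K where "K = (P + \<nu>\<^sup>2) / \<nu>\<^sup>2 * exp 2"
  \<comment> \<open>Solves \<open>C * ln K = - ln \<rho> / 2\<close>, so that the growth of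
    \<open>K ^ N\<close> uses up only half of the decay of \<open>\<rho> ^ L\<close>.\<close>
  define C where "C = - ln \<rho> / (2 * ln K)"
  have "1 + s * (1 / \<beta>) > 0" using s assms by (intro add_pos_pos) auto
  then have \<rho>: "\<rho> > 0" "\<rho> < 1" using s by (auto simp: \<rho>_def)
  have "K > 1 * 1"
    unfolding K_def using assms by (intro mult_strict_mono) (auto simp: field_simps add_pos_pos)
  then have K: "K > 1" by simp
  have C: "C > 0" using \<rho> K by (simp add: C_def divide_neg_pos)
  have "reliable_recovery_impossible \<alpha> \<nu> N L x"
    if L: "\<And>M. L M = nat \<lfloor>1 / \<beta> * real M\<rfloor>"
      and card: "\<And>M. card (supp M (x M)) = L M"
      and P: "\<And>M. L M > 0 \<Longrightarrow> (\<Sum>i<M. (cmod (x M i))\<^sup>2) = P"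
      and N: "\<And>M. M \<ge> 1 \<Longrightarrow> N M \<ge> 1"
      and prec: "asymp_prec (\<lambda>M. real (N M)) (\<lambda>M. C * real (L M))"
    for x :: "nat \<Rightarrow> nat \<Rightarrow> complex" and N L :: "nat \<Rightarrow> nat"
    unfolding reliable_recovery_impossible_def
  \<comment> \<open>The value 1/4 is what remains of 1/2 once the exponential term has dropped to
    1/4.\<close>
  proof (intro allI impI exI[of _ "1 / 4"] conjI)
    fix D assume D: "\<forall>M. decoder (N M) M (L M) (D M)"
    \<comment> \<open>Excludes the alternative in which both functions vanish identically.\<close>
    have "N 1 \<noteq> 0" using N[of 1] by simp
    then obtain M0 where M0: "\<And>M. M > M0 \<Longrightarrow> C * L M / N M > 1"
      using prec by (auto simp: asymp_succ_def)
    \<comment> \<open>For \<open>L \<ge> B\<close> the remaining factor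
      \<open>exp (L * ln \<rho> / 2)\<close> is at most 1/4.\<close>
    define B where "B = 2 * ln 4 / - ln \<rho>"
    \<comment> \<open>In the threshold \<open>\<beta> * (B + 1)\<close> the summand 1 absorbs the
      loss from the floor in \<open>L\<close>.\<close>
    show "\<forall>\<^sub>F M in sequentially. 1 / 4 \<le> p_err_unknown \<alpha> \<nu> (N M) M (D M) (x M)"
      using eventually_gt_at_top[of M0] eventually_ge_at_top[of "nat \<lceil>\<beta> * (B + 1)\<rceil>"]
        eventually_ge_at_top[of 1]
    proof eventually_elim
      case (elim M)
      \<comment> \<open>A quotient above 1 also forces its numerator to be nonzero, which gives
        \<open>L M > 0\<close> and with it the power hypothesis.\<close>
      have NC: "N M \<le> C * L M" and Lpos: "L M > 0"
        using M0[OF elim(1)] N[OF elim(3)] by (auto simp: field_simps intro: Nat.gr0I)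
      have LM: "L M / M \<le> 1 / \<beta>"
      proof -
        have "real (L M) \<le> 1 / \<beta> * M" using L[of M] assms by (simp add: of_nat_nat)
        then show ?thesis using elim(3) by (simp add: field_simps)
      qed
      have LB: "L M \<ge> B"
      proof -
        have "M \<ge> \<beta> * (B + 1)" using elim(2) by linarith
        then have "1 / \<beta> * M \<ge> B + 1" using assms by (simp add: field_simps)
        then show ?thesis using L[of M] by linarith
      qed
      have "K ^ N M = exp (N M * ln K)"
        using K by (simp add: exp_of_nat_mult)
      also have "\<dots> \<le> exp (C * L M * ln K)"
        using NC K by simp
      also have "C * L M * ln K = - (L M * ln \<rho> / 2)"
        using K by (simp add: C_def)
      finally have KN: "K ^ N M \<le> exp (- (L M * ln \<rho> / 2))" .
      have "((1 + s * (L M / M)) / (1 + s) powr (1 - \<alpha>)) ^ L M \<le> \<rho> ^ L M"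
        unfolding \<rho>_def using s LM by (intro power_mono divide_right_mono add_left_mono mult_left_mono) auto
      also have "\<rho> ^ L M = exp (L M * ln \<rho>)"
        using \<rho> by (simp add: exp_of_nat_mult)
      finally have "K ^ N M * ((1 + s * (L M / M)) / (1 + s) powr (1 - \<alpha>)) ^ L M
          \<le> exp (- (L M * ln \<rho> / 2)) * exp (L M * ln \<rho>)"
        using KN s by (intro mult_mono) auto
      also have "\<dots> = exp (L M * ln \<rho> / 2)"
        by (simp add: mult_exp_exp)
      also have "\<dots> \<le> exp (- ln 4)"
        using LB \<rho> by (simp add: B_def field_simps)
      also have "\<dots> = 1 / 4" by (simp add: exp_minus)
      finally show ?case
        using p_err_unknown_ge[OF D[rule_format] assms(5) N[OF elim(3)] s(1) Lpos card P[OF Lpos], of \<alpha>]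
        unfolding K_def by simp
    qed
  qed simp
  then show ?thesis using C by (intro exI[of _ C]) auto
qed

end
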